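(* Let $a\neq 1$ be a positive integer with $a\not\equiv 0\pmod{10}$. Then $\bar b(a)\le \tilde v(a)+2$.
   Context: For a prime $p$, $v_p$ denotes the $p$-adic valuation on $\mathbb{Z}$. For an integer $a\ge 1$, the tetration ${}^{b}a$ is defined by ${}^{1}a=a$ and ${}^{b}a=a^{({}^{b-1}a)}$ for $b\ge 2$. For an integer $a\ge 2$ not divisible by $10$ and $b\ge 1$, let $\#S(a,b)$ be the non-negative integer $n$ such that ${}^{b}a\equiv {}^{b+1}a \pmod{10^{n}}$ and ${}^{b}a\not\equiv {}^{b+1}a\pmod{10^{n+1}}$. The congruence speed of $a$ at height $b$ is $V(a,b):=\#S(a,b)-\#S(a,b-1)$ for $b\ge 2$ and $V(a,1):=\#S(a,1)$. It is known that $V(a,b)$ is constant for all sufficiently large $b$; $\bar b(a)$ denotes the smallest $b\ge 1$ such that $V(a,b)=V(a,b+k)$ for all integers $k\ge 0$. Finally, $$\tilde v(a):=\begin{cases} v_5(a-1) & \text{if } a\equiv 1\pmod 5,\\ v_5(a^2+1) & \text{if } a\equiv 2\text{ or }3\pmod 5,\\ v_5(a+1) & \text{if } a\equiv 4\pmod 5,\\ v_2(a^2-1)-1 & \text{if } a\equiv 5\pmod{10}.\end{cases}$$ *)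

theory Defs
  imports "HOL-Number_Theory.Number_Theory"
begin

text \<open>Tetration is only used for heights \<open>b \<ge> 1\<close>; the value \<open>1\<close> at height \<open>0\<close> gives
  \<open>tetration a 1 = a\<close>.\<close>

primrec tetration :: "nat \<Rightarrow> nat \<Rightarrow> nat" where
  "tetration a 0 = 1"
| "tetration a (Suc b) = a ^ tetration a b"

definition num_stable_digits :: "nat \<Rightarrow> nat \<Rightarrow> nat" where
  "num_stable_digits a b =
     (THE n. [tetration a b = tetration a (b + 1)] (mod 10 ^ n) \<and>
             \<not> [tetration a b = tetration a (b + 1)] (mod 10 ^ (n + 1)))"

text \<open>Integer-valued, so that the difference is not truncated. Meaningful for \<open>b \<ge> 1\<close>.\<close>

definition congruence_speed :: "nat \<Rightarrow> nat \<Rightarrow> int" where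
  "congruence_speed a b =
     (if b = 1 then int (num_stable_digits a 1)
      else int (num_stable_digits a b) - int (num_stable_digits a (b - 1)))"

definition stable_height :: "nat \<Rightarrow> nat" where
  "stable_height a =
     (LEAST b. 1 \<le> b \<and> (\<forall>k::nat. congruence_speed a b = congruence_speed a (b + k)))"

text \<open>The valuations are taken on the integers; for \<open>a \<ge> 2\<close> their arguments are nonzero, so
  \<^const>\<open>multiplicity\<close> is the usual \<open>p\<close>-adic valuation. The subtraction in the case
  \<open>a \<equiv> 5 (mod 10)\<close> does not truncate, since then \<open>8\<close> divides \<open>a\<^sup>2 - 1\<close>. The value \<open>0\<close> is a
  dummy for multiples of \<open>10\<close>.\<close>

definition v_tilde :: "nat \<Rightarrow> nat" where
  "v_tilde a =
     (if [a = 1] (mod 5) then multiplicity (5::int) (int a - 1)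
      else if [a = 2] (mod 5) \<or> [a = 3] (mod 5) then multiplicity (5::int) (int a ^ 2 + 1)
      else if [a = 4] (mod 5) then multiplicity (5::int) (int a + 1)
      else if [a = 5] (mod 10) then multiplicity (2::int) (int a ^ 2 - 1) - 1
      else 0)"

end

theory Submission
  imports Defs
begin

text \<open>
  Let \<open>D b\<close> be the difference of the towers of heights \<open>b + 1\<close> and \<open>b\<close>. The number of stable digits
  at height \<open>b\<close> is the minimum of the 2-adic and the 5-adic valuation of \<open>D b\<close>, and
  \<open>D (b + 1) = a ^ T b * (a ^ D b - 1)\<close> with \<open>T b\<close> the tower of height \<open>b\<close>. For \<open>p\<close> not dividing
  \<open>a\<close>, lifting the exponent makes the \<open>p\<close>-adic valuation of \<open>D b\<close>, for \<open>b \<ge> 2\<close>, an arithmetic progression in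
  \<open>b\<close>; for \<open>p\<close> dividing \<open>a\<close> that valuation is at least \<open>T (b - 1)\<close>. Hence the minimum is
  eventually an arithmetic progression, and comparing the initial terms and slopes shows that it is one
  from height \<open>v_tilde a + 1\<close> on.
\<close>

section \<open>Lifting the exponent\<close>

lemma power_one_plus_mod_square:
  fixes z :: int
  shows "z\<^sup>2 dvd (1 + z) ^ i - (1 + int i * z)"
proof (induction i)
  case (Suc i)
  have "(1 + z) ^ Suc i - (1 + int (Suc i) * z)
      = (1 + z) * ((1 + z) ^ i - (1 + int i * z)) + int i * z\<^sup>2"
    by (simp add: algebra_simps power2_eq_square)
  then show ?case using Suc by (metis dvd_add dvd_mult dvd_triv_right)
qed simp

text \<open>Factor \<open>y ^ p - 1 = (y - 1) * G\<close> with \<open>G\<close> the geometric sum.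
  Modulo \<open>p ^ 2\<close> each \<open>y ^ i\<close> is \<open>1 + i * z\<close>, and the linear
  terms add up to \<open>z * p * (p - 1) / 2\<close>, which vanishes modulo \<open>p ^ 2\<close>. So
  \<open>G\<close> is congruent to \<open>p\<close>, and \<open>p\<close> divides it exactly
  once.\<close>

lemma multiplicity_power_prime_minus_one:
  fixes y :: int and p :: nat
  assumes p: "prime p" and dvd: "int p dvd y - 1" and four: "p = 2 \<Longrightarrow> 4 dvd y - 1" and y: "y > 1"
  shows "multiplicity (int p) (y ^ p - 1) = multiplicity (int p) (y - 1) + 1"
proof -
  define z where "z = y - 1"
  define G where "G = (\<Sum>i<p. y ^ i)"
  have yz: "y = 1 + z" by (simp add: z_def)
  have "int p ^ 2 dvd G - int p"
  proof -
    have "z\<^sup>2 dvd (\<Sum>i<p. y ^ i - (1 + int i * z))"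
      unfolding yz by (intro dvd_sum power_one_plus_mod_square)
    moreover have "int p ^ 2 dvd z\<^sup>2" using dvd by (simp add: z_def dvd_power_same)
    ultimately have "int p ^ 2 dvd (\<Sum>i<p. y ^ i - (1 + int i * z))" using dvd_trans by blast
    then have 1: "int p ^ 2 dvd G - int p - (\<Sum>i<p. int i) * z"
      by (simp add: G_def sum_subtractf sum.distrib sum_distrib_right diff_diff_eq)
    have "int p ^ 2 dvd (\<Sum>i<p. int i) * z"
    proof (cases "p = 2")
      case True
      \<comment> \<open>For \<open>p = 2\<close> the sum of the indices is 1, so the hypothesis
        \<open>four\<close> is exactly what is left.\<close>
      then show ?thesis using four by (simp add: z_def numeral_2_eq_2)
    next
      case False
      then have odd: "odd p" using p prime_odd_nat prime_ge_2_nat[OF p] by force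
      have "2 * (\<Sum>i<p. int i) = int p * (int p - 1)"
      proof -
        have "2 * (\<Sum>i<n. int i) = int n * (int n - 1)" for n
          by (induction n) (auto simp: algebra_simps)
        then show ?thesis .
      qed
      then have "int p dvd 2 * (\<Sum>i<p. int i)" by simp
      moreover have "coprime (int p) 2" using odd by simp
      ultimately have "int p dvd (\<Sum>i<p. int i)" using coprime_dvd_mult_right_iff by blast
      then show ?thesis using dvd by (simp add: z_def power2_eq_square mult_dvd_mono)
    qed
    from dvd_add[OF 1 this] show ?thesis by simp
  qed
  then obtain k where "G - int p = int p ^ 2 * k" by blast
  then have k: "G = int p + int p ^ 2 * k" by simp
  have pos: "int p > 1" using p prime_gt_1_nat by simp
  have "multiplicity (int p) G = 1"
  proof (rule multiplicity_eqI)
    show "int p ^ 1 dvd G" by (simp add: k power2_eq_square)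
    have "\<not> int p dvd 1 + int p * k" using pos
      by (simp add: dvd_add_left_iff)
    moreover have "G = int p * (1 + int p * k)" by (simp add: k power2_eq_square algebra_simps)
    ultimately show "\<not> int p ^ Suc 1 dvd G" using pos by simp
  qed
  moreover have "y ^ p - 1 = (y - 1) * G" by (simp add: G_def power_diff_1_eq)
  moreover have "G \<noteq> 0" using calculation(1) by auto
  ultimately show ?thesis using p y by (simp add: prime_elem_multiplicity_mult_distrib)
qed

text \<open>Each \<open>x ^ i\<close> is 1 modulo \<open>p\<close>, so the cofactor of
  \<open>x - 1\<close> is congruent to \<open>n\<close> and hence prime to \<open>p\<close>.\<close>

lemma multiplicity_power_coprime_minus_one:
  fixes x :: int and p :: nat
  assumes p: "prime p" and dvd: "int p dvd x - 1" and x: "x > 1" and n: "\<not> p dvd n"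
  shows "multiplicity (int p) (x ^ n - 1) = multiplicity (int p) (x - 1)"
proof -
  define G where "G = (\<Sum>i<n. x ^ i)"
  have "int p dvd (\<Sum>i<n. x ^ i - 1)"
  proof (rule dvd_sum)
    fix i
    show "int p dvd x ^ i - 1" using dvd dvd_trans by (metis power_diff_1_eq dvd_triv_left)
  qed
  then have "int p dvd G - int n" by (simp add: G_def sum_subtractf)
  then have nG: "\<not> int p dvd G" using n by (metis dvd_diff_right_iff int_dvd_int_iff)
  moreover have "x ^ n - 1 = (x - 1) * G" by (simp add: G_def power_diff_1_eq)
  moreover have "G \<noteq> 0" using nG by auto
  ultimately show ?thesis using p x
    by (simp add: prime_elem_multiplicity_mult_distrib not_dvd_imp_multiplicity_0)
qed

text \<open>Factors \<open>p\<close> are stripped from \<open>n\<close> one at a time: with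
  \<open>n = p * m\<close>, the prime case applies to \<open>y = x ^ m\<close>.\<close>

lemma lifting_the_exponent:
  fixes x :: int and p :: nat
  assumes p: "prime p" and dvd: "int p dvd x - 1" and four: "p = 2 \<Longrightarrow> 4 dvd x - 1"
    and x: "x > 1" and "n > 0"
  shows "multiplicity (int p) (x ^ n - 1) = multiplicity (int p) (x - 1) + multiplicity (int p) (int n)"
  using \<open>n > 0\<close>
proof (induction n rule: less_induct)
  case (less n)
  show ?case
  proof (cases "p dvd n")
    case False
    then show ?thesis
      using multiplicity_power_coprime_minus_one[OF p dvd x] by (simp add: not_dvd_imp_multiplicity_0)
  next
    case True
    then obtain m where m: "n = p * m" by blast
    have "m > 0" "m < n" using less.prems p m prime_gt_1_nat[OF p] by auto
    have xm: "x - 1 dvd x ^ m - 1" by (metis power_diff_1_eq dvd_triv_left)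
    have "multiplicity (int p) ((x ^ m) ^ p - 1) = multiplicity (int p) (x ^ m - 1) + 1"
      using p dvd four xm x \<open>m > 0\<close>
      by (intro multiplicity_power_prime_minus_one) (auto intro: dvd_trans)
    moreover have "multiplicity (int p) (int n) = multiplicity (int p) (int m) + 1"
      using \<open>m > 0\<close> p m prime_gt_1_nat[OF p] by (simp add: multiplicity_times_same)
    ultimately show ?thesis
      using less.IH[OF \<open>m < n\<close> \<open>m > 0\<close>] m by (simp add: power_mult[symmetric] mult.commute)
  qed
qed

section \<open>Gaps between consecutive towers\<close>

text \<open>The subtraction does not truncate for \<open>a \<ge> 2\<close>. Height 0, where the gap
  is \<open>a - 1\<close>, is a convenient start for inductions.\<close>

definition tetration_gap :: "nat \<Rightarrow> nat \<Rightarrow> nat" where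
  "tetration_gap a b = tetration a (Suc b) - tetration a b"

lemma tetration_less_Suc: "a \<ge> 2 \<Longrightarrow> tetration a b < tetration a (Suc b)"
  by (induction b) auto

lemma tetration_gap_pos: "a \<ge> 2 \<Longrightarrow> tetration_gap a b > 0"
  using tetration_less_Suc[of a b] by (simp add: tetration_gap_def)

lemma tetration_gap_Suc:
  assumes "a \<ge> 2"
  shows "int (tetration_gap a (Suc b)) = int a ^ tetration a b * (int a ^ tetration_gap a b - 1)"
proof -
  have T: "tetration a (Suc b) = tetration a b + tetration_gap a b"
    using tetration_less_Suc[OF assms, of b] by (simp add: tetration_gap_def)
  have "int (tetration_gap a (Suc b)) = int (tetration a (Suc (Suc b))) - int (tetration a (Suc b))"
    using tetration_less_Suc[OF assms, of "Suc b"] unfolding tetration_gap_def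
    by (simp add: of_nat_diff del: tetration.simps)
  also have "\<dots> = int a ^ tetration a (Suc b) - int a ^ tetration a b" by simp
  also have "\<dots> = int a ^ tetration a b * (int a ^ tetration_gap a b - 1)"
    unfolding T by (simp add: power_add right_diff_distrib)
  finally show ?thesis .
qed

text \<open>As 2 and 5 are coprime, \<open>10 ^ n\<close> divides the gap exactly when
  \<open>n\<close> is at most both valuations, so the description in the definition has a unique
  solution.\<close>

lemma num_stable_digits_eq_min:
  assumes "a \<ge> 2"
  shows "num_stable_digits a b =
    min (multiplicity (2::int) (int (tetration_gap a b))) (multiplicity (5::int) (int (tetration_gap a b)))"
    (is "_ = min ?f ?g")
proof -
  have pos: "tetration_gap a b > 0" using assms by (rule tetration_gap_pos)
  have *: "[tetration a b = tetration a (b + 1)] (mod 10 ^ n) \<longleftrightarrow> n \<le> min ?f ?g" for n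
  proof -
    have "[tetration a b = tetration a (b + 1)] (mod 10 ^ n) \<longleftrightarrow> 10 ^ n dvd tetration_gap a b"
      using tetration_less_Suc[OF assms, of b] unfolding tetration_gap_def
      by (metis Suc_eq_plus1 cong_altdef_nat cong_sym_eq less_imp_le)
    also have "\<dots> \<longleftrightarrow> (10::int) ^ n dvd int (tetration_gap a b)"
      by (metis of_nat_dvd_iff of_nat_numeral of_nat_power)
    also have "\<dots> \<longleftrightarrow> (2::int) ^ n dvd int (tetration_gap a b) \<and> (5::int) ^ n dvd int (tetration_gap a b)"
    proof -
      have "coprime ((2::int) ^ n) (5 ^ n)" by (auto simp: coprime_power_left_iff coprime_power_right_iff)
      moreover have "(10::int) ^ n = 2 ^ n * 5 ^ n" by (simp add: power_mult_distrib[symmetric])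
      ultimately show ?thesis by (metis divides_mult dvd_mult_left dvd_mult_right)
    qed
    also have "\<dots> \<longleftrightarrow> n \<le> min ?f ?g"
      using pos by (subst (1 2) power_dvd_iff_le_multiplicity) auto
    finally show ?thesis .
  qed
  show ?thesis unfolding num_stable_digits_def * by (rule the_equality) auto
qed

text \<open>The speed at \<open>b\<close> compares heights \<open>b\<close> and
  \<open>b - 1\<close>, so it is constant only from one height after the linear growth sets
  in.\<close>

lemma stable_height_leI:
  assumes "N \<ge> 1" and step: "\<And>b. b \<ge> N \<Longrightarrow> num_stable_digits a (Suc b) = num_stable_digits a b + c"
  shows "stable_height a \<le> Suc N"
proof -
  have "congruence_speed a b = int c" if "b \<ge> Suc N" for b
    using step[of "b - 1"] that \<open>N \<ge> 1\<close> by (simp add: congruence_speed_def)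
  then show ?thesis unfolding stable_height_def by (intro Least_le) simp
qed

section \<open>Recursion for valuations at primes not dividing the base\<close>

lemma multiplicity_tetration_gap_Suc:
  assumes "a \<ge> 2" and p: "prime p" and pa: "\<not> p dvd a"
  shows "multiplicity (int p) (int (tetration_gap a (Suc b)))
       = multiplicity (int p) (int a ^ tetration_gap a b - 1)"
proof -
  have "int a ^ tetration_gap a b > 1" using assms tetration_gap_pos[of a b] by simp
  moreover have "multiplicity (int p) (int a ^ tetration a b) = 0"
    using p pa by (metis int_dvd_int_iff not_dvd_imp_multiplicity_0 of_nat_power prime_dvd_power)
  ultimately show ?thesis using assms
    by (simp add: tetration_gap_Suc prime_elem_multiplicity_mult_distrib)
qed

text \<open>Lifting the exponent for \<open>x = a ^ d\<close>, raised to the gap divided by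
  \<open>d\<close>. It serves \<open>p = 2\<close> with \<open>d = 2\<close> and
  \<open>p = 5\<close> with \<open>d\<close> the order of \<open>a\<close>.\<close>

lemma multiplicity_tetration_gap_step:
  assumes "a \<ge> 2" and p: "prime p" and pa: "\<not> p dvd a"
    and d: "int p dvd int a ^ d - 1" "p = 2 \<Longrightarrow> 4 dvd int a ^ d - 1" "d dvd tetration_gap a b"
  shows "multiplicity (int p) (int (tetration_gap a (Suc b))) + multiplicity (int p) (int d)
       = multiplicity (int p) (int a ^ d - 1) + multiplicity (int p) (int (tetration_gap a b))"
proof -
  have pos: "tetration_gap a b > 0" using assms(1) by (rule tetration_gap_pos)
  obtain m where m: "tetration_gap a b = d * m" using d(3) by blast
  with pos have "d > 0" "m > 0" by auto
  then have "int a ^ d > 1" using assms by simp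
  then have "multiplicity (int p) ((int a ^ d) ^ m - 1)
      = multiplicity (int p) (int a ^ d - 1) + multiplicity (int p) (int m)"
    using p d \<open>m > 0\<close> by (intro lifting_the_exponent) auto
  then show ?thesis using p \<open>d > 0\<close> \<open>m > 0\<close>
    by (simp add: multiplicity_tetration_gap_Suc[OF assms(1) p pa] m power_mult
        prime_elem_multiplicity_mult_distrib)
qed

section \<open>The 2-adic valuation for odd bases\<close>

lemma even_tetration_gap: "odd a \<Longrightarrow> even (tetration_gap a b)"
proof -
  assume "odd a"
  then have "odd (tetration a b)" for b by (induction b) auto
  then show ?thesis by (simp add: tetration_gap_def del: tetration.simps)
qed

text \<open>The slope comes from the step with \<open>d = 2\<close>; the 1 subtracted in it is the
  valuation of \<open>d\<close>.\<close>

lemma multiplicity_2_tetration_gap: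
  assumes "odd a" "a \<ge> 2"
  shows "multiplicity (2::int) (int (tetration_gap a b))
    = multiplicity (2::int) (int a - 1) + b * (multiplicity (2::int) (int a ^ 2 - 1) - 1)"
proof (induction b)
  case (Suc b)
  have 8: "8 dvd int a ^ 2 - 1"
  proof -
    obtain k where k: "int a = 2 * k + 1" using assms(1) by (metis even_of_nat oddE)
    have "even (k * (k + 1))" by simp
    then obtain j where "k * (k + 1) = 2 * j" by blast
    then have "int a ^ 2 - 1 = 8 * j" by (simp add: k power2_eq_square algebra_simps)
    then show ?thesis by simp
  qed
  have "int a ^ 2 > 1" using assms by simp
  then have "multiplicity (2::int) (int a ^ 2 - 1) > 0"
    using 8 assms(1) by (subst multiplicity_gt_zero_iff) auto
  moreover have "multiplicity (2::int) (int (tetration_gap a (Suc b))) + multiplicity (2::int) 2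
       = multiplicity (2::int) (int a ^ 2 - 1) + multiplicity (2::int) (int (tetration_gap a b))"
    using multiplicity_tetration_gap_step[of a 2 2 b] assms even_tetration_gap[of a b] 8
    by (auto elim: dvd_trans[rotated])
  ultimately show ?case using Suc.IH by (cases "multiplicity (2::int) (int a ^ 2 - 1)") auto
qed (use assms in \<open>simp add: tetration_gap_def of_nat_diff\<close>)

section \<open>The 5-adic valuation for bases prime to 5\<close>

lemma tetration_mono: "a \<ge> 2 \<Longrightarrow> b \<le> c \<Longrightarrow> tetration a b \<le> tetration a c"
  by (rule lift_Suc_mono_le[of "tetration a"])
    (simp_all only: less_imp_le[OF tetration_less_Suc])

text \<open>The order of \<open>a\<close> modulo 5 divides 4, so this makes the 5-adic step
  available. Even bases have to wait for height 2: for \<open>a = 2\<close> the gap at height 1 is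
  2.\<close>

lemma four_dvd_tetration_gap:
  assumes "a \<ge> 2" and "b \<ge> 2 \<or> odd a \<and> b \<ge> 1"
  shows "4 dvd tetration_gap a b"
proof -
  obtain n where n: "b = Suc n" using assms(2) by (cases b) auto
  have "(4::int) dvd int (tetration_gap a b)"
  proof (cases "even a")
    case True
    then have "b \<ge> 2" using assms by auto
    then have "tetration a n \<ge> tetration a 1" using n assms by (intro tetration_mono) auto
    then have "(2::int) ^ 2 dvd int a ^ tetration a n"
      using assms True by (intro dvd_power_le) auto
    then show ?thesis using assms by (simp add: n tetration_gap_Suc)
  next
    case False
    have "(4::int) dvd int a ^ tetration_gap a n - 1"
    proof -
      obtain m where m: "tetration_gap a n = 2 * m" using even_tetration_gap False by blast
      obtain k where k: "int a = 2 * k + 1" using False by (metis even_of_nat oddE)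
      have "int a ^ 2 - 1 = 4 * (k * (k + 1))" by (simp add: k power2_eq_square algebra_simps)
      then have "4 dvd int a ^ 2 - 1" by simp
      also have "int a ^ 2 - 1 dvd (int a ^ 2) ^ m - 1" by (metis power_diff_1_eq dvd_triv_left)
      finally show ?thesis by (simp add: m power_mult)
    qed
    then show ?thesis using assms by (simp add: n tetration_gap_Suc)
  qed
  then show ?thesis by presburger
qed

lemma five_dvd_power_minus_one_iff: "5 dvd int a ^ n - 1 \<longleftrightarrow> ord 5 a dvd n"
proof -
  have "5 dvd int a ^ n - 1 \<longleftrightarrow> [int (a ^ n) = int 1] (mod int 5)"
    by (simp add: cong_iff_dvd_diff)
  then show ?thesis by (simp only: cong_int_iff ord_divides)
qed

lemma ord_5_dvd_4:
  fixes a :: nat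
  assumes "\<not> 5 dvd a"
  shows "ord 5 a dvd 4"
  using fermat_theorem[of 5 a] assms by (simp add: ord_divides')

text \<open>The order is 1, 4, 4, 2 for the residues 1, 2, 3, 4. In the factorizations of
  \<open>a ^ 4 - 1\<close> and \<open>a ^ 2 - 1\<close> one factor is prime to 5, and the other is
  the argument in \<open>v_tilde\<close>.\<close>

lemma multiplicity_5_power_ord_minus_one:
  assumes "a \<ge> 2" "\<not> 5 dvd a"
  shows "multiplicity (5::int) (int a ^ ord 5 a - 1) = v_tilde a"
proof -
  define r where "r = a mod 5"
  have cong: "[a = k] (mod 5) \<longleftrightarrow> r = k mod 5" for k by (simp add: r_def cong_def)
  have one: "ord 5 a dvd n \<longleftrightarrow> r ^ n mod 5 = 1" for n
    by (simp add: ord_divides[symmetric] cong_def r_def power_mod)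
  have "r < 5" by (simp add: r_def)
  moreover have "r \<noteq> 0" using assms(2) by (simp add: r_def dvd_eq_mod_eq_0)
  ultimately consider "r = 1" | "r = 2 \<or> r = 3" | "r = 4" by linarith
  then show ?thesis
  proof cases
    case 1
    then have "ord 5 a = 1" using one[of 1] by simp
    then show ?thesis using 1 by (simp add: v_tilde_def cong)
  next
    case 2
    have "\<not> ord 5 a dvd 2" using 2 one[of 2] by auto
    moreover have "m = 4" if "m dvd 4" "\<not> m dvd 2" for m :: nat
    proof -
      have "m \<le> 4" using that by (simp add: dvd_imp_le)
      then consider "m = 0" | "m = 1" | "m = 2" | "m = 3" | "m = 4" by linarith
      then show ?thesis using that by cases auto
    qed
    ultimately have "ord 5 a = 4" using ord_5_dvd_4[OF assms(2)] by blast
    moreover have "int a ^ 4 - 1 = (int a ^ 2 + 1) * (int a ^ 2 - 1)"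
      by (simp add: algebra_simps power_add[symmetric])
    moreover have "\<not> 5 dvd int a ^ 2 - 1"
      using \<open>\<not> ord 5 a dvd 2\<close> by (simp add: five_dvd_power_minus_one_iff)
    moreover from this have "int a ^ 2 - 1 \<noteq> 0" by auto
    moreover have "int a ^ 2 + 1 \<noteq> 0" using zero_le_power2[of "int a"] by linarith
    ultimately show ?thesis using 2
      by (simp add: v_tilde_def cong prime_elem_multiplicity_mult_distrib not_dvd_imp_multiplicity_0)
         auto
  next
    case 3
    have n1: "\<not> ord 5 a dvd 1" using 3 one[of 1] by simp
    have "ord 5 a dvd 2" using 3 one[of 2] by simp
    then have "ord 5 a = 2" using n1 by (metis dvd_refl prime_nat_iff two_is_prime_nat)
    moreover have "int a ^ 2 - 1 = (int a + 1) * (int a - 1)"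
      by (simp add: algebra_simps power2_eq_square)
    moreover have "\<not> 5 dvd int a - 1" using n1 five_dvd_power_minus_one_iff[of a 1] by simp
    ultimately show ?thesis using 3 assms
      by (simp add: v_tilde_def cong prime_elem_multiplicity_mult_distrib not_dvd_imp_multiplicity_0)
  qed
qed

lemma v_tilde_pos:
  assumes "a \<ge> 2" "\<not> 5 dvd a"
  shows "v_tilde a > 0"
proof -
  have "ord 5 a > 0" using ord_5_dvd_4[OF assms(2)] by (cases "ord 5 a = 0") auto
  then have "int a ^ ord 5 a > 1" using assms by simp
  then show ?thesis using five_dvd_power_minus_one_iff[of a "ord 5 a"]
    by (simp add: multiplicity_5_power_ord_minus_one[OF assms, symmetric] multiplicity_gt_zero_iff)
qed

text \<open>If the order divides the gap, the step lemma applies with \<open>d\<close> the order,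
  which is prime to 5 as a divisor of 4. Otherwise 5 does not divide
  \<open>a ^ tetration_gap a b - 1\<close>.\<close>

lemma multiplicity_5_tetration_gap_Suc:
  assumes "a \<ge> 2" "\<not> 5 dvd a"
  shows "multiplicity (5::int) (int (tetration_gap a (Suc b))) =
    (if ord 5 a dvd tetration_gap a b
     then v_tilde a + multiplicity (5::int) (int (tetration_gap a b)) else 0)"
proof (cases "ord 5 a dvd tetration_gap a b")
  case True
  have "\<not> 5 dvd ord 5 a" using ord_5_dvd_4[OF assms(2)] by (auto dest: dvd_trans dvd_imp_le)
  then have "multiplicity (5::int) (int (ord 5 a)) = 0"
    by (metis int_dvd_int_iff not_dvd_imp_multiplicity_0 of_nat_numeral)
  then show ?thesis
    using multiplicity_tetration_gap_step[of a 5 "ord 5 a" b] assms True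
    by (simp add: five_dvd_power_minus_one_iff multiplicity_5_power_ord_minus_one)
next
  case False
  then show ?thesis
    using multiplicity_tetration_gap_Suc[of a 5 b] assms
    by (simp add: not_dvd_imp_multiplicity_0 five_dvd_power_minus_one_iff)
qed

lemma multiplicity_5_tetration_gap_eventually:
  assumes "a \<ge> 2" "\<not> 5 dvd a" and "b \<ge> 2 \<or> odd a \<and> b \<ge> 1"
  shows "multiplicity (5::int) (int (tetration_gap a (Suc b))) =
    v_tilde a + multiplicity (5::int) (int (tetration_gap a b))"
  using multiplicity_5_tetration_gap_Suc[OF assms(1,2), of b]
    dvd_trans[OF ord_5_dvd_4[OF assms(2)] four_dvd_tetration_gap[OF assms(1,3)]] by simp

text \<open>The gap at height 0 is \<open>a - 1\<close>, a divisor of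
  \<open>a ^ ord 5 a - 1\<close>.\<close>

lemma multiplicity_5_tetration_gap_0_le:
  assumes "a \<ge> 2" "\<not> 5 dvd a"
  shows "multiplicity (5::int) (int (tetration_gap a 0)) \<le> v_tilde a"
proof -
  have "ord 5 a > 0" using ord_5_dvd_4[OF assms(2)] by (cases "ord 5 a = 0") auto
  then have "int a ^ ord 5 a > 1" using assms by simp
  moreover have "int (tetration_gap a 0) = int a - 1" using assms by (simp add: tetration_gap_def of_nat_diff)
  moreover have "int a - 1 dvd int a ^ ord 5 a - 1" by (metis power_diff_1_eq dvd_triv_left)
  ultimately show ?thesis
    by (simp add: multiplicity_5_power_ord_minus_one[OF assms, symmetric] dvd_imp_multiplicity_le)
qed

section \<open>Bases coprime to 10\<close>

lemma multiplicity_2_eq_1: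
  fixes x :: int
  assumes "x mod 4 = 2"
  shows "multiplicity 2 x = 1"
proof (rule multiplicity_eqI)
  show "2 ^ 1 dvd x" using assms by simp presburger
  show "\<not> 2 ^ Suc 1 dvd x" using assms by (simp add: dvd_eq_mod_eq_0)
qed

text \<open>One of \<open>a - 1\<close> and \<open>a + 1\<close> is 2 modulo 4 and has valuation 1.
  So the 2-adic progression starts either at its own slope or at 1.\<close>

lemma multiplicity_2_square_minus_one:
  assumes "odd a" "a \<ge> 2"
  shows "a mod 4 = 1 \<and> multiplicity (2::int) (int a - 1) = multiplicity (2::int) (int a ^ 2 - 1) - 1
    \<or> a mod 4 = 3 \<and> multiplicity (2::int) (int a - 1) = 1"
proof -
  have "a mod 4 = 1 \<or> a mod 4 = 3" using assms(1) by presburger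
  then show ?thesis
  proof
    assume a: "a mod 4 = 1"
    then have "multiplicity (2::int) (int a + 1) = 1" by (intro multiplicity_2_eq_1) presburger
    moreover have "int a ^ 2 - 1 = (int a - 1) * (int a + 1)"
      by (simp add: algebra_simps power2_eq_square)
    ultimately show ?thesis using a assms by (simp add: prime_elem_multiplicity_mult_distrib)
  next
    assume a: "a mod 4 = 3"
    then have "multiplicity (2::int) (int a - 1) = 1" by (intro multiplicity_2_eq_1) presburger
    then show ?thesis using a by simp
  qed
qed

text \<open>
  The 2-adic progression has slope \<open>s\<close> and value \<open>u\<close> at height 0, the 5-adic one has slope \<open>t\<close> and
  value \<open>v\<close> at height 1; the disjunction distinguishes \<open>a mod 4 = 1\<close> from \<open>a mod 4 = 3\<close>.
\<close>

lemma min_arith_progressions: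
  fixes u v s t n :: nat
  assumes "v \<le> 2 * t" and "u = s \<and> v \<ge> t \<or> u = 1" and "t \<le> n"
  shows "min (u + Suc (Suc n) * s) (v + Suc n * t) = min (u + Suc n * s) (v + n * t) + min s t"
proof -
  consider "s = t" | "s < t" | "t < s" by linarith
  then show ?thesis
  proof cases
    case 1
    then show ?thesis by simp
  next
    case 2
    \<comment> \<open>After \<open>n\<close> steps the steeper progression has gained at least
      \<open>n \<ge> t\<close>, which makes up for the initial values; from here on the minimum
      follows the smaller slope.\<close>
    then have "n * Suc s \<le> n * t" by (intro mult_le_mono2) simp
    then have "u + Suc n * s \<le> v + n * t" using assms 2 by auto
    then show ?thesis using 2 by simp
  next
    case 3
    then have "n * Suc t \<le> n * s" by (intro mult_le_mono2) simp
    then have "v + n * t \<le> u + Suc n * s" using assms 3 by auto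
    then show ?thesis using 3 by simp
  qed
qed

lemma stable_height_odd:
  assumes "a \<ge> 2" "odd a" "\<not> 5 dvd a"
  shows "stable_height a \<le> v_tilde a + 2"
proof -
  let ?f = "\<lambda>b. multiplicity (2::int) (int (tetration_gap a b))"
  let ?g = "\<lambda>b. multiplicity (5::int) (int (tetration_gap a b))"
  define s where "s = multiplicity (2::int) (int a ^ 2 - 1) - 1"
  define u where "u = multiplicity (2::int) (int a - 1)"
  have f: "?f b = u + b * s" for b
    using multiplicity_2_tetration_gap[OF assms(2,1)] by (simp add: u_def s_def)
  have g: "?g (Suc n) = ?g 1 + n * v_tilde a" for n
    by (induction n) (use multiplicity_5_tetration_gap_eventually[OF assms(1,3)] assms in auto)
  have "?g 1 \<le> 2 * v_tilde a"
    using multiplicity_5_tetration_gap_Suc[OF assms(1,3), of 0]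
      multiplicity_5_tetration_gap_0_le[OF assms(1,3)] by auto
  moreover have "u = s \<and> ?g 1 \<ge> v_tilde a \<or> u = 1"
    using multiplicity_2_square_minus_one[OF assms(2,1)]
  proof
    assume *: "a mod 4 = 1 \<and> multiplicity (2::int) (int a - 1) = multiplicity (2::int) (int a ^ 2 - 1) - 1"
    \<comment> \<open>Here the 5-adic step already works from height 0, which gives the lower bound
      at height 1.\<close>
    then have "4 dvd tetration_gap a 0" by (simp add: tetration_gap_def) presburger
    then have "ord 5 a dvd tetration_gap a 0" using ord_5_dvd_4[OF assms(3)] dvd_trans by blast
    then show ?thesis using * multiplicity_5_tetration_gap_Suc[OF assms(1,3), of 0]
      by (simp add: u_def s_def)
  qed (simp add: u_def)
  ultimately have *: "min (?f (Suc (Suc n))) (?g (Suc (Suc n)))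
      = min (?f (Suc n)) (?g (Suc n)) + min s (v_tilde a)" if "n \<ge> v_tilde a" for n
    unfolding f g[of "Suc n"] g[of n] using min_arith_progressions that by blast
  have "stable_height a \<le> Suc (Suc (v_tilde a))"
  proof (rule stable_height_leI)
    fix b assume "b \<ge> Suc (v_tilde a)"
    then show "num_stable_digits a (Suc b) = num_stable_digits a b + min s (v_tilde a)"
      using *[of "b - 1"] by (cases b) (simp_all add: num_stable_digits_eq_min[OF assms(1)])
  qed simp
  then show ?thesis by simp
qed

section \<open>Bases divisible by 2 or 5\<close>

text \<open>The valuation at the prime not dividing \<open>a\<close> will be at most
  \<open>(n + 2) * v_tilde a\<close> at height \<open>n + 1\<close>. For
  \<open>n \<ge> v_tilde a\<close> this is at most \<open>n * (n + 2)\<close>, hence the shape of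
  the bound.\<close>

lemma tetration_ge_quadratic:
  assumes "a \<ge> 4" "n \<ge> 1"
  shows "tetration a n \<ge> n * (n + 2)"
  using assms(2)
proof (induction n rule: nat_induct_at_least)
  case (Suc n)
  have four: "4 * m \<le> 4 ^ m" for m :: nat
  proof (induction m)
    case (Suc m)
    then show ?case by (cases m) auto
  qed simp
  have "Suc n * (Suc n + 2) \<le> 4 * (n * (n + 2))"
    using Suc.hyps by (simp add: algebra_simps)
  also have "\<dots> \<le> 4 ^ (n * (n + 2))" by (rule four)
  also have "\<dots> \<le> a ^ tetration a n" using assms Suc.IH
    by (intro order.trans[OF power_mono power_increasing]) auto
  finally show ?case by simp
qed (use assms in auto)

lemma le_multiplicity_tetration_gap:
  assumes "a \<ge> 2" "prime p" "p dvd a"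
  shows "tetration a b \<le> multiplicity (int p) (int (tetration_gap a (Suc b)))"
proof (rule multiplicity_geI)
  show "int p ^ tetration a b dvd int (tetration_gap a (Suc b))"
    using assms by (simp add: tetration_gap_Suc dvd_power_same dvd_mult2)
qed (use assms tetration_gap_pos[of a "Suc b"] prime_gt_1_nat[of p] in auto)

lemma tetration_ge: "a \<ge> 2 \<Longrightarrow> n \<le> tetration a n"
proof (induction n)
  case (Suc n)
  then show ?case using tetration_less_Suc[of a n] by linarith
qed simp

text \<open>The 2-adic valuation is at least a tower and the 5-adic one is linearly bounded, so the
  latter is the minimum from height \<open>v_tilde a + 1\<close> on.\<close>

lemma stable_height_even:
  assumes "a \<ge> 2" "even a" "\<not> 5 dvd a"
  shows "stable_height a \<le> v_tilde a + 2"
proof -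
  let ?f = "\<lambda>b. multiplicity (2::int) (int (tetration_gap a b))"
  let ?g = "\<lambda>b. multiplicity (5::int) (int (tetration_gap a b))"
  have g_le: "?g b \<le> (b + 1) * v_tilde a" for b
    by (induction b)
      (use multiplicity_5_tetration_gap_0_le[OF assms(1,3)] multiplicity_5_tetration_gap_Suc[OF assms(1,3)] in auto)
  have f_ge: "?f (Suc n) \<ge> tetration a n" for n
    using le_multiplicity_tetration_gap[of a 2 n] assms by simp
  have min: "num_stable_digits a (Suc n) = ?g (Suc n)" if n: "n \<ge> v_tilde a" for n
  proof -
    have "n \<ge> 1" using n v_tilde_pos[OF assms(1,3)] by simp
    have "?g (Suc n) \<le> tetration a n"
    proof (cases "a = 2")
      \<comment> \<open>The quadratic lower bound on the tower fails for \<open>a = 2\<close> at height 1.\<close>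
      case True
      have [simp]: "v_tilde a = 1" by (simp add: True v_tilde_def cong_def)
      \<comment> \<open>The gap at height 1 is 2, of valuation 0, which saves 2 against the general
        bound \<open>m + 2\<close>.\<close>
      have "?g (Suc m) \<le> m" for m
      proof (induction m)
        case 0
        have "tetration_gap a 1 = 2" by (simp add: True tetration_gap_def)
        then show ?case by (simp add: not_dvd_imp_multiplicity_0)
      next
        case (Suc m)
        then show ?case using multiplicity_5_tetration_gap_Suc[OF assms(1,3), of "Suc m"] by auto
      qed
      then show ?thesis using tetration_ge[OF assms(1), of n] le_trans by blast
    next
      case False
      then have "a \<ge> 4" using assms by presburger
      have "?g (Suc n) \<le> (n + 2) * v_tilde a" using g_le[of "Suc n"] by simp
      also have "\<dots> \<le> n * (n + 2)" by (subst mult.commute) (rule mult_le_mono1[OF n])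
      also have "\<dots> \<le> tetration a n" using \<open>a \<ge> 4\<close> \<open>n \<ge> 1\<close> by (rule tetration_ge_quadratic)
      finally show ?thesis .
    qed
    then show ?thesis using f_ge[of n] by (simp add: num_stable_digits_eq_min[OF assms(1)])
  qed
  have "stable_height a \<le> Suc (Suc (v_tilde a))"
  proof (rule stable_height_leI)
    fix b assume b: "b \<ge> Suc (v_tilde a)"
    \<comment> \<open>For even \<open>a\<close> the 5-adic progression is only guaranteed from
      height 2; positivity of \<open>v_tilde a\<close> ensures this.\<close>
    then have "b \<ge> 2" using v_tilde_pos[OF assms(1,3)] by simp
    then show "num_stable_digits a (Suc b) = num_stable_digits a b + v_tilde a"
      using b min[of b] min[of "b - 1"] multiplicity_5_tetration_gap_eventually[OF assms(1,3), of b] by simp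
  qed simp
  then show ?thesis by simp
qed

text \<open>The primes exchange roles: the 5-adic valuation is at least a tower, and the 2-adic one
  is linear with slope \<open>v_tilde a\<close>.\<close>

lemma stable_height_multiple_of_5:
  assumes "a \<ge> 2" "odd a" "5 dvd a"
  shows "stable_height a \<le> v_tilde a + 2"
proof -
  let ?f = "\<lambda>b. multiplicity (2::int) (int (tetration_gap a b))"
  let ?g = "\<lambda>b. multiplicity (5::int) (int (tetration_gap a b))"
  define s where "s = multiplicity (2::int) (int a ^ 2 - 1) - 1"
  have "a mod 5 = 0" "a mod 10 = 5" using assms by presburger+
  then have v: "v_tilde a = s" by (simp add: v_tilde_def cong_def s_def)
  have f: "?f b = multiplicity (2::int) (int a - 1) + b * s" for b
    using multiplicity_2_tetration_gap[OF assms(2,1)] by (simp add: s_def)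
  have a1: "int a ^ 2 - 1 = (int a - 1) * (int a + 1)"
    by (simp add: algebra_simps power2_eq_square)
  have "multiplicity (2::int) (int a + 1) \<ge> 1" "multiplicity (2::int) (int a - 1) \<ge> 1"
    using assms by (auto intro!: multiplicity_geI)
  \<comment> \<open>Since \<open>a + 1\<close> takes at least one factor 2 of
    \<open>a ^ 2 - 1\<close>, the initial value is at most the slope.\<close>
  then have u: "multiplicity (2::int) (int a - 1) \<le> s" "s \<ge> 1"
    using assms unfolding s_def a1 by (auto simp: prime_elem_multiplicity_mult_distrib)
  have min: "num_stable_digits a (Suc n) = ?f (Suc n)" if n: "n \<ge> s" for n
  proof -
    have "?f (Suc n) \<le> (n + 2) * s" using u by (simp add: f)
    also have "\<dots> \<le> n * (n + 2)" by (subst mult.commute) (rule mult_le_mono1[OF n])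
    also have "\<dots> \<le> tetration a n" using n u assms
      by (intro tetration_ge_quadratic) (auto dest: dvd_imp_le)
    also have "\<dots> \<le> ?g (Suc n)" using le_multiplicity_tetration_gap[of a 5 n] assms by simp
    finally show ?thesis by (simp add: num_stable_digits_eq_min[OF assms(1)])
  qed
  have "stable_height a \<le> Suc (Suc s)"
  proof (rule stable_height_leI)
    fix b assume b: "b \<ge> Suc s"
    then show "num_stable_digits a (Suc b) = num_stable_digits a b + s"
      using min[of b] min[of "b - 1"] by (simp add: f)
  qed simp
  then show ?thesis by (simp add: v)
qed

theorem mainTheorem11:
  fixes a :: nat
  assumes "a > 0" and "a \<noteq> 1" and "\<not> [a = 0] (mod 10)"
  shows "stable_height a \<le> v_tilde a + 2"
proof -
  have a: "a \<ge> 2" using assms by simp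
  have "\<not> (even a \<and> 5 dvd a)" using assms(3) by (auto simp: cong_def)
  then show ?thesis
    using a stable_height_odd stable_height_even stable_height_multiple_of_5 by blast
qed

end
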